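(* For all $k\ge 1$ and $n\ge 0$, the matrix $M_k^{(n)}$ is double stochastic, i.e. the sum of each row and of each column of $M_k^{(n)}$ is equal to $1$.
   Context: For $k\ge1$ define real $2^n\times 2^n$ matrices $a_0^{(n)},\dots,a_k^{(n)}$, $n=0,1,2,\dots$, by $a_i^{(0)}=1$ for all $i=0,\dots,k$ and the block recursion (where $0$ denotes the $2^n\times 2^n$ null matrix) $$a_0^{(n+1)}=\begin{pmatrix} a_0^{(n)} & a_1^{(n)}\\ 0&0\end{pmatrix},\qquad a_i^{(n+1)}=\begin{pmatrix} 0 & a_{i+1}^{(n)}\\ a_{i-1}^{(n)}&0\end{pmatrix}\ (1\le i\le k-1),\qquad a_k^{(n+1)}=\begin{pmatrix} 0&0\\ a_{k-1}^{(n)} & a_k^{(n)}\end{pmatrix}.$$ The transition operator of the box-ball system with carrier capacity $k$ at level $n$ is $$M_k^{(n)}=\frac{1}{2k+2}\sum_{i=0}^k\left(a_i^{(n)}+a_i^{(n)*}\right),$$ where $*$ denotes the transpose. *)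

theory Defs
  imports "Jordan_Normal_Form.Matrix"
begin

text \<open>\<open>bbs_a k n i\<close> is the matrix \<open>a\<^sub>i\<close> of level \<open>n\<close> for carrier capacity \<open>k\<close>. It is meaningful
  only for \<open>k \<ge> 1\<close> and \<open>i \<le> k\<close>; the recursion never leaves this range of \<open>i\<close>.\<close>

fun bbs_a :: "nat \<Rightarrow> nat \<Rightarrow> nat \<Rightarrow> real mat" where
  "bbs_a k 0 i = 1\<^sub>m 1"
| "bbs_a k (Suc n) i =
    (let Z = 0\<^sub>m (2 ^ n) (2 ^ n) in
     if i = 0 then four_block_mat (bbs_a k n 0) (bbs_a k n 1)
                                  Z             Z
     else if i = k then four_block_mat Z                   Z
                                       (bbs_a k n (k - 1)) (bbs_a k n k)
     else four_block_mat Z                   (bbs_a k n (i + 1))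
                         (bbs_a k n (i - 1)) Z)"

lemma bbs_a_carrier: "bbs_a k n i \<in> carrier_mat (2 ^ n) (2 ^ n)"
proof (induction n arbitrary: i)
  case 0
  show ?case by simp
next
  case (Suc n)
  have "(2::nat) ^ Suc n = 2 ^ n + 2 ^ n" by simp
  then show ?case
    using Suc.IH by (auto simp: Let_def simp del: power_Suc)
qed

text \<open>The sum over \<open>i\<close> is taken entrywise because \<open>real mat\<close>, containing matrices of all
  dimensions, is not an additive monoid.\<close>

definition bbs_M :: "nat \<Rightarrow> nat \<Rightarrow> real mat" where
  "bbs_M k n = (1 / (2 * real k + 2)) \<cdot>\<^sub>m
     mat (2 ^ n) (2 ^ n) (\<lambda>rc. \<Sum>i = 0..k. (bbs_a k n i + transpose_mat (bbs_a k n i)) $$ rc)"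

definition double_stochastic :: "real mat \<Rightarrow> bool" where
  "double_stochastic A \<longleftrightarrow>
     square_mat A \<and>
     (\<forall>r < dim_row A. \<forall>c < dim_col A. 0 \<le> A $$ (r, c)) \<and>
     (\<forall>r < dim_row A. (\<Sum>c < dim_col A. A $$ (r, c)) = 1) \<and>
     (\<forall>c < dim_col A. (\<Sum>r < dim_row A. A $$ (r, c)) = 1)"

lemma bbs_M_carrier: "bbs_M k n \<in> carrier_mat (2 ^ n) (2 ^ n)"
  by (simp add: bbs_M_def)

end

theory Submission
  imports Defs
begin

text \<open>Since \<open>bbs_M k n\<close> is the symmetrised sum of \<open>a\<^sub>0, \<dots>, a\<^sub>k\<close> divided by \<open>2k + 2\<close>, both its row
  and its column sums are obtained by adding the \<open>r\<close>-th row sum and the \<open>r\<close>-th column sum of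
  \<open>a\<^sub>0 + \<dots> + a\<^sub>k\<close>. It therefore suffices that each of these two numbers is \<open>k + 1\<close>, and they are so
  for different reasons.

  For columns, every single \<open>a\<^sub>i\<close> already has all column sums \<open>1\<close>: each block column of
  \<open>a\<^sub>i\<close> consists of one matrix of the previous level and one zero block, so the property is
  inherited (\<open>bbs_a_col_sum\<close>).

  For rows, the individual \<open>a\<^sub>i\<close> do not in general have constant row sums (the lower half of
  \<open>a\<^sub>0\<close> vanishes from level \<open>1\<close> on),
  but their total at level \<open>n + 1\<close> has, in terms of the matrices of level \<open>n\<close>, the upper blocks
  \<open>a\<^sub>0\<close> and \<open>a\<^sub>1 + \<dots> + a\<^sub>k\<close> and the lower blocks \<open>a\<^sub>0 + \<dots> + a\<^bsub>k-1\<^esub>\<close> and \<open>a\<^sub>k\<close>. Each block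
  row uses every \<open>a\<^sub>i\<close> exactly once, so the total row sums do not change from one level to the
  next (\<open>bbs_a_total_row_sum\<close>).\<close>

lemma sum_lessThan_add:
  fixes f :: "nat \<Rightarrow> 'a :: comm_monoid_add"
  shows "(\<Sum>j<m + n. f j) = (\<Sum>j<m. f j) + (\<Sum>j<n. f (m + j))"
  by (induction n) (auto simp: add.assoc)

lemma four_block_mat_row_sum:
  assumes "A \<in> carrier_mat m p" "B \<in> carrier_mat m q"
    and "C \<in> carrier_mat l p" "D \<in> carrier_mat l q" and "r < m + l"
  shows "(\<Sum>c<p + q. four_block_mat A B C D $$ (r, c)) =
    (if r < m then (\<Sum>c<p. A $$ (r, c)) + (\<Sum>c<q. B $$ (r, c))
     else (\<Sum>c<p. C $$ (r - m, c)) + (\<Sum>c<q. D $$ (r - m, c)))"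
  using assms by (auto simp: sum_lessThan_add)

lemma four_block_mat_col_sum:
  assumes "A \<in> carrier_mat m p" "B \<in> carrier_mat m q"
    and "C \<in> carrier_mat l p" "D \<in> carrier_mat l q" and "c < p + q"
  shows "(\<Sum>r<m + l. four_block_mat A B C D $$ (r, c)) =
    (if c < p then (\<Sum>r<m. A $$ (r, c)) + (\<Sum>r<l. C $$ (r, c))
     else (\<Sum>r<m. B $$ (r, c - p)) + (\<Sum>r<l. D $$ (r, c - p)))"
  using assms by (auto simp: sum_lessThan_add)

lemma bbs_a_dim [simp]: "dim_row (bbs_a k n i) = 2 ^ n" "dim_col (bbs_a k n i) = 2 ^ n"
  using bbs_a_carrier[of k n i] by auto

lemma bbs_a_nonneg:
  assumes "r < 2 ^ n" "c < 2 ^ n"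
  shows "0 \<le> bbs_a k n i $$ (r, c)"
  using assms
proof (induction n arbitrary: i r c)
  case (Suc n)
  have "r - 2 ^ n < 2 ^ n" "c - 2 ^ n < 2 ^ n"
    using Suc.prems by auto
  then show ?case
    using Suc by (auto simp: Let_def)
qed auto

text \<open>In each of the three shapes of the recursion, the left and the right block column hold one
  matrix of the previous level above or below a zero block; which one it is does not matter, so
  the induction runs over all indices at once.\<close>

lemma bbs_a_col_sum:
  assumes "c < 2 ^ n"
  shows "(\<Sum>r<2 ^ n. bbs_a k n i $$ (r, c)) = 1"
  using assms
proof (induction n arbitrary: i c)
  case (Suc n)
  let ?N = "2 ^ n :: nat"
  have double: "2 ^ Suc n = ?N + ?N" by simp
  have c: "c < ?N + ?N" "\<not> c < ?N \<Longrightarrow> c - ?N < ?N"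
    using Suc.prems by auto
  note block = four_block_mat_col_sum[where m = ?N and l = ?N and p = ?N and q = ?N,
      OF _ _ _ _ c(1)]
  show ?case
    unfolding double using c
    by (auto simp: Let_def block bbs_a_carrier Suc.IH simp del: index_mat_four_block)
qed simp

lemma bbs_a_Suc_row_sum:
  fixes k n r :: nat
  assumes "r < 2 ^ Suc n"
  defines "R \<equiv> \<lambda>i r. \<Sum>c<2 ^ n. bbs_a k n i $$ (r, c)"
  shows "(\<Sum>c<2 ^ Suc n. bbs_a k (Suc n) i $$ (r, c)) =
    (if r < 2 ^ n
     then if i = 0 then R 0 r + R 1 r else if i = k then 0 else R (i + 1) r
     else if i = 0 then 0 else if i = k then R (k - 1) (r - 2 ^ n) + R k (r - 2 ^ n)
     else R (i - 1) (r - 2 ^ n))"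
proof -
  let ?N = "2 ^ n :: nat"
  have double: "2 ^ Suc n = ?N + ?N" by simp
  have r: "r < ?N + ?N" "\<not> r < ?N \<Longrightarrow> r - ?N < ?N"
    using assms(1) by auto
  note block = four_block_mat_row_sum[where m = ?N and l = ?N and p = ?N and q = ?N,
      OF _ _ _ _ r(1)]
  show ?thesis
    unfolding double R_def using r
    by (auto simp: Let_def block bbs_a_carrier simp del: index_mat_four_block)
qed

text \<open>Going up one level only permutes the summands: in the upper half, \<open>a\<^sub>0\<close> takes over the
  indices \<open>0\<close> and \<open>1\<close> and the middle matrices the indices \<open>2, \<dots>, k\<close>; in the lower half the
  middle matrices take over \<open>0, \<dots>, k - 2\<close> and \<open>a\<^sub>k\<close> the last two. For \<open>k = 0\<close> the total would
  refer to the index \<open>1\<close>, outside the range of the sum.\<close>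

lemma bbs_a_total_row_sum:
  assumes "k \<ge> 1" "r < 2 ^ n"
  shows "(\<Sum>i\<le>k. \<Sum>c<2 ^ n. bbs_a k n i $$ (r, c)) = real k + 1"
  using assms(2)
proof (induction n arbitrary: r)
  case (Suc n)
  obtain m where k: "k = Suc m"
    using assms(1) by (cases k) auto
  define R where "R = (\<lambda>i r. \<Sum>c<2 ^ n. bbs_a k n i $$ (r, c))"
  define R' where "R' = (\<lambda>i. \<Sum>c<2 ^ Suc n. bbs_a k (Suc n) i $$ (r, c))"
  have R': "R' i =
    (if r < 2 ^ n
     then if i = 0 then R 0 r + R 1 r else if i = k then 0 else R (i + 1) r
     else if i = 0 then 0 else if i = k then R (k - 1) (r - 2 ^ n) + R k (r - 2 ^ n)
     else R (i - 1) (r - 2 ^ n))" for i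
    unfolding R_def R'_def by (rule bbs_a_Suc_row_sum[OF Suc.prems])
  \<comment> \<open>The two extreme indices follow their own recursion, so they are split off from the sum.\<close>
  have total: "(\<Sum>i\<le>k. R' i) = R' 0 + (\<Sum>i<m. R' (Suc i)) + R' k"
    unfolding k sum.atMost_Suc by (simp add: lessThan_Suc_atMost[symmetric] sum.lessThan_Suc_shift
        del: sum.lessThan_Suc)
  show ?case
  proof (cases "r < 2 ^ n")
    case True
    have "(\<Sum>i\<le>k. R' i) = R 0 r + (R 1 r + (\<Sum>i<m. R (Suc (Suc i)) r))"
      unfolding total using True by (simp add: R' k)
    also have "\<dots> = (\<Sum>i\<le>k. R i r)"
      unfolding k by (simp add: lessThan_Suc_atMost[symmetric] sum.lessThan_Suc_shift
          del: sum.lessThan_Suc)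
    also have "\<dots> = real k + 1"
      unfolding R_def using True by (rule Suc.IH)
    finally show ?thesis by (simp add: R'_def)
  next
    case False
    let ?r = "r - 2 ^ n"
    have "(\<Sum>i\<le>k. R' i) = (\<Sum>i<m. R i ?r) + R m ?r + R k ?r"
      unfolding total using False by (simp add: R' k)
    also have "\<dots> = (\<Sum>i\<le>k. R i ?r)"
      unfolding k by (simp add: lessThan_Suc_atMost[symmetric])
    also have "\<dots> = real k + 1"
      unfolding R_def using Suc.prems by (intro Suc.IH) auto
    finally show ?thesis by (simp add: R'_def)
  qed
qed simp

lemma bbs_M_index:
  assumes "r < 2 ^ n" "c < 2 ^ n"
  shows "bbs_M k n $$ (r, c) =
    ((\<Sum>i\<le>k. bbs_a k n i $$ (r, c)) + (\<Sum>i\<le>k. bbs_a k n i $$ (c, r))) / (2 * real k + 2)"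
  using assms by (simp add: bbs_M_def atLeast0AtMost sum.distrib)

lemma bbs_M_sym:
  assumes "r < 2 ^ n" "c < 2 ^ n"
  shows "bbs_M k n $$ (r, c) = bbs_M k n $$ (c, r)"
  using assms by (simp add: bbs_M_index add.commute)

lemma bbs_M_row_sum:
  assumes "k \<ge> 1" "r < 2 ^ n"
  shows "(\<Sum>c<2 ^ n. bbs_M k n $$ (r, c)) = 1"
proof -
  have rows: "(\<Sum>c<2 ^ n. \<Sum>i\<le>k. bbs_a k n i $$ (r, c)) = real k + 1"
    by (subst sum.swap) (rule bbs_a_total_row_sum[OF assms])
  have cols: "(\<Sum>c<2 ^ n. \<Sum>i\<le>k. bbs_a k n i $$ (c, r)) = real k + 1"
    by (subst sum.swap) (simp add: bbs_a_col_sum[OF assms(2)])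
  have "(\<Sum>c<2 ^ n. bbs_M k n $$ (r, c)) = ((real k + 1) + (real k + 1)) / (2 * real k + 2)"
    using assms(2) by (simp add: bbs_M_index sum.distrib rows cols flip: sum_divide_distrib)
  then show ?thesis by simp
qed

theorem proposition4p1:
  fixes k n :: nat
  assumes "k \<ge> 1"
  shows "double_stochastic (bbs_M k n)"
proof -
  have dim: "dim_row (bbs_M k n) = 2 ^ n" "dim_col (bbs_M k n) = 2 ^ n"
    using bbs_M_carrier[of k n] by auto
  have nonneg: "0 \<le> bbs_M k n $$ (r, c)" if "r < 2 ^ n" "c < 2 ^ n" for r c
    using that by (simp add: bbs_M_index bbs_a_nonneg sum_nonneg)
  have col: "(\<Sum>r<2 ^ n. bbs_M k n $$ (r, c)) = 1" if "c < 2 ^ n" for c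
    using bbs_M_row_sum[OF assms that] bbs_M_sym[OF that, of _ k] by simp
  show ?thesis
    unfolding double_stochastic_def square_mat.simps dim
    using nonneg bbs_M_row_sum[OF assms] col by blast
qed

end
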